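(* Let $n\geq 1$ be an integer, and let $D_n$ be the convex segment disjointness graph on $n$ points in strictly convex position in the plane. Then $$\chi(D_n)=n-\left\lfloor\sqrt{2n+\tfrac14}-\tfrac12\right\rfloor ,$$ where $\chi$ denotes the chromatic number.
   Context: Let $P$ be a set of $n$ points in strictly convex position in the plane (every point of $P$ is a vertex of the convex hull of $P$, and no three points of $P$ are collinear). The convex segment disjointness graph $D_n$ is the graph whose vertex set is the set of all $\binom n2$ closed line segments with two distinct endpoints in $P$, where two vertices are adjacent if and only if the corresponding segments are disjoint (they have no point in common; in particular, segments sharing an endpoint are not adjacent). Up to isomorphism, $D_n$ does not depend on the choice of $P$. *)

theory Defs
  imports "HOL-Analysis.Analysis" "Graph_Theory.Pair_Digraph"
begin

text \<open>A finite simple graph is represented as a \<open>pair_graph\<close>: a finite digraph whose arcs form a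
  symmetric, irreflexive relation, so each undirected edge appears in both orientations.\<close>

definition proper_coloring :: "'v pair_pre_digraph \<Rightarrow> nat \<Rightarrow> ('v \<Rightarrow> nat) \<Rightarrow> bool" where
  "proper_coloring G k c \<longleftrightarrow>
     c ` pverts G \<subseteq> {..<k} \<and> (\<forall>(u, v) \<in> parcs G. c u \<noteq> c v)"

definition chromatic_number :: "'v pair_pre_digraph \<Rightarrow> nat" where
  "chromatic_number G = (LEAST k. \<exists>c. proper_coloring G k c)"

definition strictly_convex_position :: "(real^2) set \<Rightarrow> bool" where
  "strictly_convex_position P \<longleftrightarrow>
     (\<forall>p \<in> P. p extreme_point_of (convex hull P)) \<and>
     (\<forall>a \<in> P. \<forall>b \<in> P. \<forall>c \<in> P. a \<noteq> b \<and> b \<noteq> c \<and> a \<noteq> c \<longrightarrow> \<not> collinear {a, b, c})"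

definition segments :: "(real^2) set \<Rightarrow> (real^2) set set" where
  "segments P = {closed_segment a b | a b. a \<in> P \<and> b \<in> P \<and> a \<noteq> b}"

definition segment_disjointness_graph :: "(real^2) set \<Rightarrow> (real^2) set pair_pre_digraph" where
  "segment_disjointness_graph P =
     \<lparr>pverts = segments P,
      parcs = {(s, t). s \<in> segments P \<and> t \<in> segments P \<and> s \<inter> t = {}}\<rparr>"

lemma finite_segments:
  assumes "finite P"
  shows "finite (segments P)"
proof -
  have "segments P \<subseteq> (\<lambda>(a, b). closed_segment a b) ` (P \<times> P)"
    by (auto simp: segments_def)
  then show ?thesis
    using assms by (meson finite_SigmaI finite_imageI finite_subset)
qed

lemma pair_graph_segment_disjointness_graph:
  assumes "finite P"
  shows "pair_graph (segment_disjointness_graph P)"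
proof -
  have ne: "s \<noteq> {}" if "s \<in> segments P" for s
    using that unfolding segments_def by force
  have "parcs (segment_disjointness_graph P) \<subseteq> segments P \<times> segments P"
    by (auto simp: segment_disjointness_graph_def)
  then have "finite (parcs (segment_disjointness_graph P))"
    by (meson assms finite_SigmaI finite_segments finite_subset)
  moreover have "symmetric (with_proj (segment_disjointness_graph P))"
    unfolding symmetric_def with_proj_simps
    by (rule symI) (simp add: segment_disjointness_graph_def Int_commute)
  moreover have "fst e \<in> segments P \<and> snd e \<in> segments P \<and> fst e \<noteq> snd e"
    if "e \<in> parcs (segment_disjointness_graph P)" for e
    using that ne by (cases e) (auto simp: segment_disjointness_graph_def)
  moreover have "pverts (segment_disjointness_graph P) = segments P"
    by (simp add: segment_disjointness_graph_def)
  ultimately show ?thesis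
    using finite_segments[OF assms] by unfold_locales simp_all
qed

text \<open>On a finite loop-free graph the minimum defining the chromatic number is attained.\<close>

lemma (in pair_graph) chromatic_number_attained:
  "\<exists>c. proper_coloring G (chromatic_number G) c"
proof -
  obtain c where c: "inj_on c (pverts G)" "c ` pverts G = {..<card (pverts G)}"
    using ex_bij_betw_finite_nat[OF pair_finite_verts]
    by (auto simp: bij_betw_def lessThan_atLeast0)
  have "proper_coloring G (card (pverts G)) c"
    unfolding proper_coloring_def
  proof (intro conjI ballI)
    fix e assume e: "e \<in> parcs G"
    obtain u v where uv: "e = (u, v)" by (cases e)
    have "u \<in> pverts G" "v \<in> pverts G" "u \<noteq> v"
      using arc_fst_in_verts[OF e] arc_snd_in_verts[OF e] pair_no_loops[OF e] by (simp_all add: uv)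
    then show "case e of (u, v) \<Rightarrow> c u \<noteq> c v"
      using inj_on_eq_iff[OF c(1), of u v] by (simp add: uv)
  qed (simp add: c(2))
  then have "\<exists>k c. proper_coloring G k c"
    by blast
  then show ?thesis
    unfolding chromatic_number_def by (rule LeastI_ex)
qed

end

theory Submission
  imports Defs
begin

text \<open>
  Number the points cyclically by \<open>0, \<dots>, n - 1\<close>; two segments are disjoint iff, as pairs \<open>a < b\<close>, they
  are separated or strictly nested. Colour classes are thus thrackles, families of pairwise meeting
  pairs, and a thrackle has at most \<open>n\<close> members.

  Lower bound: among the covers of all pairs by \<open>k\<close> thrackles take one of maximal total length.
  Then all thrackles are maximal, and no doubly covered pair can be pushed outwards. If two of the
  thrackles contain \<open>(0, n - 1)\<close>, they can be removed together with the points \<open>0\<close> and \<open>n - 1\<close>.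
  Otherwise every two thrackles share a pair, and these coincidences can be counted without loss,
  so that \<open>n choose 2 \<le> k * n - (k choose 2)\<close>. With \<open>t = n - k\<close> this says \<open>t * (t + 1) \<le> 2 * n\<close>.

  Upper bound: cut the points into consecutive blocks of sizes \<open>1, 2, 3, \<dots>\<close>. There is one class for
  each point that is not the last of its block: a double star centred at this point and its
  successor.
\<close>

section \<open>Index pairs, thrackles and covers\<close>

fun apart :: "nat \<times> nat \<Rightarrow> nat \<times> nat \<Rightarrow> bool" where
  "apart (a, b) (c, d) \<longleftrightarrow> b < c \<or> d < a \<or> a < c \<and> d < b \<or> c < a \<and> b < d"

definition edges :: "nat \<Rightarrow> (nat \<times> nat) set" where
  "edges n = {(a, b). a < b \<and> b < n}"

text \<open>The classes may overlap. Colour classes form a partition, but the extremal argument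
  needs room to enlarge classes.\<close>

definition thrackle_cover :: "nat \<Rightarrow> 'i set \<Rightarrow> ('i \<Rightarrow> (nat \<times> nat) set) \<Rightarrow> bool" where
  "thrackle_cover n I T \<longleftrightarrow>
     (\<forall>i\<in>I. \<forall>e\<in>T i. \<forall>f\<in>T i. \<not> apart e f) \<and> (\<Union>i\<in>I. T i) = edges n"

text \<open>The potential to be maximised: a pair counts once for every class that contains it, so
  enlarging a class raises the value.\<close>

definition total_length :: "'i set \<Rightarrow> ('i \<Rightarrow> (nat \<times> nat) set) \<Rightarrow> nat" where
  "total_length I T = (\<Sum>i\<in>I. \<Sum>(a, b)\<in>T i. b - a)"

lemma mem_edges [simp]: "(a, b) \<in> edges n \<longleftrightarrow> a < b \<and> b < n"
  by (simp add: edges_def)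

lemma apart_commute: "apart e f \<longleftrightarrow> apart f e"
  by (cases e; cases f) auto

lemma finite_edges [simp]: "finite (edges n)"
  by (rule finite_subset[of _ "{..<n} \<times> {..<n}"]) (auto simp: edges_def)

lemma card_edges: "2 * card (edges n) + n = n * n"
proof -
  let ?R = "(\<lambda>(a, b). (b, a)) ` edges n" and ?D = "(\<lambda>a. (a, a)) ` {..<n}"
  have "card (edges n \<union> ?R \<union> ?D) = card (edges n) + card ?R + card ?D"
    by (subst card_Un_disjoint; auto)+
  moreover have "card ?R = card (edges n)"
    by (rule card_image) (auto simp: inj_on_def)
  moreover have "card ?D = n"
    by (subst card_image) (auto simp: inj_on_def)
  moreover have "edges n \<union> ?R \<union> ?D = {..<n} \<times> {..<n}"
    by (auto simp: edges_def image_iff)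
  ultimately show ?thesis
    by simp
qed

text \<open>Edges with the same \<open>a + b\<close> modulo \<open>n\<close> are parallel.\<close>
lemma card_thrackle_le:
  assumes "S \<subseteq> edges n" and meet: "\<And>e f. e \<in> S \<Longrightarrow> f \<in> S \<Longrightarrow> \<not> apart e f"
  shows "card S \<le> n"
proof -
  have inj: "inj_on (\<lambda>(a, b). (a + b) mod n) S"
  proof (rule inj_onI, clarify)
    fix a b c d assume S: "(a, b) \<in> S" "(c, d) \<in> S" and eq: "(a + b) mod n = (c + d) mod n"
    have lt: "a < b" "b < n" "c < d" "d < n"
      using S assms(1) by auto
    have na: "\<not> apart (a, b) (c, d)"
      using S meet by blast
    have "(a + b) mod n = (if a + b < n then a + b else a + b - n)"
      "(c + d) mod n = (if c + d < n then c + d else c + d - n)"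
      using lt by (auto simp: le_mod_geq)
    with eq lt na show "a = c \<and> b = d"
      by (auto split: if_splits)
  qed
  have "card S = card ((\<lambda>(a, b). (a + b) mod n) ` S)"
    by (simp add: card_image inj)
  also have "\<dots> \<le> card {..<n}"
    using assms(1) by (intro card_mono) (auto simp: edges_def)
  finally show ?thesis by simp
qed

subsection \<open>Thrackle covers of maximal total length\<close>

text \<open>With \<open>m + 2\<close> points, \<open>0\<close> and \<open>Suc m\<close> are
  distinct, and deleting them leaves \<open>m\<close> points.\<close>

locale optimal_cover =
  fixes m :: nat and I :: "'i set" and T :: "'i \<Rightarrow> (nat \<times> nat) set"
  assumes finite_I: "finite I"
    and cover: "thrackle_cover (m + 2) I T"
    and optimal: "\<And>T'. thrackle_cover (m + 2) I T' \<Longrightarrow> total_length I T' \<le> total_length I T"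
begin

lemma meet: "i \<in> I \<Longrightarrow> e \<in> T i \<Longrightarrow> f \<in> T i \<Longrightarrow> \<not> apart e f"
  using cover by (auto simp: thrackle_cover_def)

lemma Union_eq: "(\<Union>i\<in>I. T i) = edges (m + 2)"
  using cover by (simp add: thrackle_cover_def)

lemma bounds: "(a, b) \<in> T i \<Longrightarrow> i \<in> I \<Longrightarrow> a < b \<and> b \<le> Suc m"
  using Union_eq mem_edges[of a b "m + 2"] by (metis UN_I add_2_eq_Suc' less_Suc_eq_le)

lemma finite_T: "i \<in> I \<Longrightarrow> finite (T i)"
  using Union_eq finite_edges[of "m + 2"] by (metis UN_upper finite_subset)

lemma total_length_upd:
  assumes "i \<in> I"
  shows "total_length I (T(i := S)) + (\<Sum>(a, b)\<in>T i. b - a) = total_length I T + (\<Sum>(a, b)\<in>S. b - a)"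
proof -
  have "(\<Sum>j\<in>I - {i}. \<Sum>(a, b)\<in>(T(i := S)) j. b - a) = (\<Sum>j\<in>I - {i}. \<Sum>(a, b)\<in>T j. b - a)"
    by (rule sum.cong) auto
  then show ?thesis
    using assms finite_I by (simp add: total_length_def sum.remove[of I i])
qed

text \<open>Otherwise adding the pair to \<open>T i\<close> would give a cover whose total length is
  larger by \<open>b - a > 0\<close>.\<close>

lemma maximal:
  assumes "i \<in> I" "a < b" "b \<le> Suc m" and meets: "\<And>f. f \<in> T i \<Longrightarrow> \<not> apart (a, b) f"
  shows "(a, b) \<in> T i"
proof (rule ccontr)
  assume new: "(a, b) \<notin> T i"
  have "\<not> apart (a, b) (a, b)"
    using assms by simp
  then have "thrackle_cover (m + 2) I (T(i := insert (a, b) (T i)))"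
    using cover meets assms Union_eq unfolding thrackle_cover_def
    by (auto simp: apart_commute split: if_splits)
  then have "total_length I (T(i := insert (a, b) (T i))) \<le> total_length I T"
    by (rule optimal)
  then show False
    using total_length_upd[OF assms(1), of "insert (a, b) (T i)"] new assms(2) finite_T[OF assms(1)]
    by simp
qed

text \<open>A doubly covered middle edge of a zigzag can be replaced by the longer edge opposite to it.\<close>
lemma zigzag:
  assumes "i \<in> I" "j \<in> I" "i \<noteq> j" "y \<le> m"
    and z: "(x, y) \<in> T i" "(Suc x, y) \<in> T i" "(Suc x, Suc y) \<in> T i"
  shows "(Suc x, y) \<notin> T j"
proof
  assume j: "(Suc x, y) \<in> T j"
  let ?S = "insert (x, Suc y) (T i - {(Suc x, y)})"
  have lt: "Suc x < y"
    using bounds z(2) assms(1) by blast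
  \<comment> \<open>A pair other than \<open>(Suc x, y)\<close> strictly inside
    \<open>(x, Suc y)\<close> is strictly inside one of the three zigzag edges. Pairs separated from
    \<open>(x, Suc y)\<close> or surrounding it are already apart from
    \<open>(Suc x, y)\<close>.\<close>
  have meets: "\<not> apart (x, Suc y) f" if f: "f \<in> T i" "f \<noteq> (Suc x, y)" for f
  proof -
    obtain a b where ab: "f = (a, b)" by (cases f)
    have "\<not> apart (x, y) (a, b)" "\<not> apart (Suc x, y) (a, b)" "\<not> apart (Suc x, Suc y) (a, b)" "a < b"
      using meet[OF assms(1)] z f bounds assms(1) by (auto simp: ab simp del: apart.simps)
    then show ?thesis
      using f(2) by (simp add: ab) linarith
  qed
  have S: "\<not> apart e f" if "e \<in> ?S" "f \<in> ?S" for e f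
  proof (cases "e = (x, Suc y)")
    case True
    have "\<not> apart (x, Suc y) (x, Suc y)" using lt by simp
    then show ?thesis using True that(2) meets by blast
  next
    case False
    then show ?thesis
      using that meet[OF assms(1)] meets[of e] apart_commute[of e f] by blast
  qed
  have new: "(x, Suc y) \<notin> T i"
    using meet[OF assms(1) _ z(2), of "(x, Suc y)"] by auto
  have "thrackle_cover (m + 2) I (T(i := ?S))"
    unfolding thrackle_cover_def
  proof (intro conjI)
    show "\<forall>l\<in>I. \<forall>e\<in>(T(i := ?S)) l. \<forall>f\<in>(T(i := ?S)) l. \<not> apart e f"
      using meet S by (auto simp del: apart.simps split: if_splits)
    have "(\<Union>l\<in>I. (T(i := ?S)) l) = insert (x, Suc y) (\<Union>l\<in>I. T l)"
      using assms(1,2,3) j by (auto split: if_splits)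
    then show "(\<Union>l\<in>I. (T(i := ?S)) l) = edges (m + 2)"
      using Union_eq lt assms(4) by auto
  qed
  then have "total_length I (T(i := ?S)) \<le> total_length I T"
    by (rule optimal)
  \<comment> \<open>The exchange gains exactly 2 in length.\<close>
  moreover have "(\<Sum>(a, b)\<in>?S. b - a) > (\<Sum>(a, b)\<in>T i. b - a)"
    using new z(2) lt finite_T[OF assms(1)] by (simp add: sum.remove[of "T i" "(Suc x, y)"])
  ultimately show False
    using total_length_upd[OF assms(1), of ?S] by simp
qed

text \<open>A maximal thrackle can be traced by steps that lower the sum of the endpoints by one. If
  \<open>(x, y)\<close> is absent, some member is apart from it; since that member meets
  \<open>(Suc x, y)\<close>, it is \<open>(Suc x, b)\<close> with \<open>b < y\<close>, so
  \<open>(Suc x, y - 1)\<close> is a genuine pair. A member apart from the latter is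
  \<open>(y, d)\<close> or \<open>(c, y)\<close> with \<open>c <= x\<close>, and both are apart from
  \<open>(Suc x, b)\<close>.\<close>

lemma predecessor:
  assumes "i \<in> I" "(Suc x, y) \<in> T i"
  shows "(x, y) \<in> T i \<or> Suc x < y - 1 \<and> (Suc x, y - 1) \<in> T i"
proof (rule ccontr)
  assume neg: "\<not> ?thesis"
  have b: "Suc x < y" "y \<le> Suc m"
    using bounds assms by blast+
  obtain a b where g: "(a, b) \<in> T i" "apart (x, y) (a, b)"
    using maximal[OF assms(1), of x y] neg b by fastforce
  have g': "\<not> apart (Suc x, y) (a, b)" "a < b"
    using meet[OF assms(1,2)] g bounds assms(1) by blast+
  then have ab: "a = Suc x" "b < y"
    using g(2) b by (simp; linarith)+
  then have "Suc x < y - 1"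
    using g' by linarith
  then obtain c d where h: "(c, d) \<in> T i" "apart (Suc x, y - 1) (c, d)"
    using maximal[OF assms(1), of "Suc x" "y - 1"] neg b by fastforce
  have h': "\<not> apart (Suc x, y) (c, d)" "c < d" "\<not> apart (a, b) (c, d)"
    using meet[OF assms(1)] assms(2) g h bounds assms(1) by blast+
  show False
    using h(2) h' ab g' b by (simp; linarith)
qed

text \<open>Mirror image of \<open>predecessor\<close> under reversal of the points: the sum of the
  endpoints rises by one.\<close>

lemma successor:
  assumes "i \<in> I" "(x, y) \<in> T i" "y \<le> m"
  shows "(x, Suc y) \<in> T i \<or> Suc x < y \<and> (Suc x, y) \<in> T i"
proof (rule ccontr)
  assume neg: "\<not> ?thesis"
  have b: "x < y"
    using bounds assms by blast
  obtain a b where g: "(a, b) \<in> T i" "apart (x, Suc y) (a, b)"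
    using maximal[OF assms(1), of x "Suc y"] neg b assms(3) by fastforce
  have g': "\<not> apart (x, y) (a, b)" "a < b"
    using meet[OF assms(1,2)] g bounds assms(1) by blast+
  then have ab: "b = y" "x < a"
    using g(2) b by (simp; linarith)+
  then have "Suc x < y"
    using g' by linarith
  then obtain c d where h: "(c, d) \<in> T i" "apart (Suc x, y) (c, d)"
    using maximal[OF assms(1), of "Suc x" y] neg b assms(3) by fastforce
  have h': "\<not> apart (x, y) (c, d)" "c < d" "\<not> apart (a, b) (c, d)"
    using meet[OF assms(1)] assms(2) g h bounds assms(1) by blast+
  show False
    using h(2) h' ab g' b by (simp; linarith)
qed

text \<open>\<open>zigzag\<close> rules out the first alternative of \<open>predecessor\<close> for
  both classes, so a shared upward step forces the shared step just below it. This descent cannot go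
  on forever.\<close>

lemma up_step_unique:
  assumes "i \<in> I" "j \<in> I" "i \<noteq> j" "y \<le> m"
    and "(Suc x, y) \<in> T i" "(Suc x, Suc y) \<in> T i" "(Suc x, y) \<in> T j" "(Suc x, Suc y) \<in> T j"
  shows False
  using assms(4-8)
proof (induction y)
  case 0
  then show ?case using bounds[OF 0(2) assms(1)] by simp
next
  case (Suc y)
  have "(Suc x, y) \<in> T i" if "i \<in> I" "j \<in> I" "i \<noteq> j" "(Suc x, Suc y) \<in> T i" "(Suc x, Suc (Suc y)) \<in> T i"
    "(Suc x, Suc y) \<in> T j" for i j
    using predecessor[OF that(1,4)] zigzag[OF that(1-3) Suc.prems(1) _ that(4,5)] that(6) by auto
  from this[OF assms(1-3)] this[OF assms(2,1)] show ?case
    using Suc assms(3) by auto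
qed

text \<open>The same argument with \<open>successor\<close>: a shared step to the right forces the
  next one, and the pairs shrink.\<close>

lemma right_step_unique:
  assumes "i \<in> I" "j \<in> I" "i \<noteq> j" "y \<le> m"
    and "(x, y) \<in> T i" "(Suc x, y) \<in> T i" "(x, y) \<in> T j" "(Suc x, y) \<in> T j"
  shows False
  using assms(5-8)
proof (induction "y - x" arbitrary: x rule: less_induct)
  case less
  have "(Suc (Suc x), y) \<in> T i" if "i \<in> I" "j \<in> I" "i \<noteq> j" "(x, y) \<in> T i" "(Suc x, y) \<in> T i"
    "(Suc x, y) \<in> T j" for i j
    using successor[OF that(1,5) assms(4)] zigzag[OF that(1-3) assms(4) that(4,5)] that(6) by auto
  from this[OF assms(1-3)] this[OF assms(2,1)]
  have "(Suc (Suc x), y) \<in> T i" "(Suc (Suc x), y) \<in> T j"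
    using less.prems assms(3) by auto
  then show ?case
    using less.hyps[of "Suc x"] less.prems bounds[OF less.prems(2) assms(1)]
    by (simp add: diff_less_mono2)
qed

text \<open>By \<open>successor\<close> each of the three classes leaves the pair upwards or to the
  right, so two of them share a step.\<close>

lemma interior_multiplicity:
  assumes "{i, j, l} \<subseteq> I" "i \<noteq> j" "i \<noteq> l" "j \<noteq> l" "y \<le> m"
    and "(Suc x, y) \<in> T i" "(Suc x, y) \<in> T j" "(Suc x, y) \<in> T l"
  shows False
proof -
  have I: "i \<in> I" "j \<in> I" "l \<in> I" using assms(1) by auto
  show False
    using successor[OF I(1) assms(6,5)] successor[OF I(2) assms(7,5)] successor[OF I(3) assms(8,5)]
      up_step_unique[OF I(1,2) assms(2,5,6) _ assms(7)] up_step_unique[OF I(1,3) assms(3,5,6) _ assms(8)]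
      up_step_unique[OF I(2,3) assms(4,5,7) _ assms(8)]
      right_step_unique[OF I(1,2) assms(2,5,6) _ assms(7)] right_step_unique[OF I(1,3) assms(3,5,6) _ assms(8)]
      right_step_unique[OF I(2,3) assms(4,5,7) _ assms(8)]
    by blast
qed

lemma ex_first:
  assumes "i \<in> I"
  shows "\<exists>v. (0, v) \<in> T i"
proof -
  have "\<exists>v. (0, v) \<in> T i" if "(x, y) \<in> T i" for x y
    using that
  proof (induction "x + y" arbitrary: x y rule: less_induct)
    case less
    show ?case
    proof (cases x)
      case (Suc x')
      then show ?thesis
        using predecessor[OF assms, of x' y] less.prems less.hyps[of x' y] less.hyps[of x "y - 1"]
        by fastforce
    qed (use less.prems in blast)
  qed
  moreover have "T i \<noteq> {}"
    using maximal[OF assms, of 0 1] by auto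
  ultimately show ?thesis by auto
qed

lemma ex_last:
  assumes "i \<in> I"
  shows "\<exists>w. (w, Suc m) \<in> T i"
proof -
  have "\<exists>w. (w, Suc m) \<in> T i" if "(x, y) \<in> T i" for x y
    using that
  proof (induction "2 * m + 2 - (x + y)" arbitrary: x y rule: less_induct)
    case less
    have b: "x < y" "y \<le> Suc m"
      using bounds less.prems assms by blast+
    show ?case
    proof (cases "y = Suc m")
      case False
      then show ?thesis
        using successor[OF assms less.prems] less.hyps[of x "Suc y"] less.hyps[of "Suc x" y] b
        by fastforce
    qed (use less.prems in blast)
  qed
  then show ?thesis
    using ex_first[OF assms] by blast
qed

section \<open>Extreme edges at the two end points, and pairs shared by two classes\<close>

definition v :: "'i \<Rightarrow> nat" where "v i = Max {y. (0, y) \<in> T i}"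
definition w :: "'i \<Rightarrow> nat" where "w i = Min {x. (x, Suc m) \<in> T i}"

lemma v_mem: "i \<in> I \<Longrightarrow> (0, v i) \<in> T i" and v_max: "i \<in> I \<Longrightarrow> (0, y) \<in> T i \<Longrightarrow> y \<le> v i"
proof -
  assume i: "i \<in> I"
  have "finite {y. (0, y) \<in> T i}"
    by (rule finite_subset[of _ "{..Suc m}"]) (use i bounds in auto)
  then show "(0, v i) \<in> T i" "(0, y) \<in> T i \<Longrightarrow> y \<le> v i"
    using Max_in[of "{y. (0, y) \<in> T i}"] Max_ge[of "{y. (0, y) \<in> T i}" y] ex_first[OF i]
    by (auto simp: v_def)
qed

lemma w_mem: "i \<in> I \<Longrightarrow> (w i, Suc m) \<in> T i" and w_min: "i \<in> I \<Longrightarrow> (x, Suc m) \<in> T i \<Longrightarrow> w i \<le> x"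
proof -
  assume i: "i \<in> I"
  have "finite {x. (x, Suc m) \<in> T i}"
    by (rule finite_subset[of _ "{..Suc m}"]) (use i bounds in fastforce)+
  then show "(w i, Suc m) \<in> T i" "(x, Suc m) \<in> T i \<Longrightarrow> w i \<le> x"
    using Min_in[of "{x. (x, Suc m) \<in> T i}"] Min_le[of "{x. (x, Suc m) \<in> T i}" x] ex_last[OF i]
    by (auto simp: w_def)
qed

lemma v_le: "i \<in> I \<Longrightarrow> v i \<le> Suc m"
  using v_mem bounds by blast

lemma v_eq_w_eq: "i \<in> I \<Longrightarrow> v i = Suc m \<longleftrightarrow> w i = 0"
  using v_mem w_mem v_max[of i "Suc m"] w_min[of i 0] v_le[of i] by fastforce

text \<open>If both pairs are absent from \<open>T j\<close>, each is apart from some member of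
  \<open>T j\<close>. The first such member must meet \<open>(0, v j)\<close>, hence starts after
  \<open>v i\<close>; the second must meet \<open>(w j, Suc m)\<close>, hence ends before
  \<open>w i\<close>. As \<open>w i <= v i\<close>, these two members are apart.\<close>

lemma nested:
  assumes "i \<in> I" "j \<in> I" "v i < v j" "w j < w i"
  shows "(0, v i) \<in> T j \<or> (w i, Suc m) \<in> T j"
proof (rule ccontr)
  assume neg: "\<not> ?thesis"
  have b: "0 < v i" "v i \<le> Suc m" "w i < Suc m"
    using bounds v_mem w_mem assms by blast+
  have "\<not> apart (0, v i) (w i, Suc m)"
    using meet v_mem w_mem assms by blast
  then have vw: "w i \<le> v i" by auto
  obtain a b where g: "(a, b) \<in> T j" "apart (0, v i) (a, b)"
    using maximal[OF assms(2), of 0 "v i"] neg b by fastforce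
  obtain c d where h: "(c, d) \<in> T j" "apart (w i, Suc m) (c, d)"
    using maximal[OF assms(2), of "w i" "Suc m"] neg b by fastforce
  have "\<not> apart (0, v j) (a, b)" "\<not> apart (w j, Suc m) (c, d)" "\<not> apart (a, b) (c, d)"
    using meet[OF assms(2)] v_mem w_mem g h assms(2) by blast+
  moreover have "a < b" "c < d" "b \<le> Suc m" "d \<le> Suc m"
    using bounds g h assms(2) by blast+
  ultimately show False
    using g(2) h(2) vw assms(3,4) by (simp; linarith)
qed

text \<open>A discrete intermediate value argument. Both classes are traced by
  \<open>successor\<close> in lockstep, so the endpoint sums stay equal. While
  \<open>x' < x\<close>, one step cannot make the difference negative, so the paths coincide before
  leaving the interior.\<close>

lemma interior_sweep:
  assumes "i \<in> I" "j \<in> I" "w i < w j" "x + y = x' + y'" "0 < x'" "x' \<le> x" "y' \<le> m"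
    and "(x, y) \<in> T i" "(x', y') \<in> T j"
  shows "\<exists>a b. 0 < a \<and> b \<le> m \<and> (a, b) \<in> T i \<and> (a, b) \<in> T j"
  using assms(4-)
proof (induction "2 * m - (x + y)" arbitrary: x y x' y' rule: less_induct)
  case less
  show ?case
  proof (cases "x = x'")
    case True
    then show ?thesis using less.prems by auto
  next
    case False
    then have x: "x' < x" "y < y'" using less.prems by linarith+
    have b: "x < y" "x' < y'"
      using bounds less.prems assms(1,2) by blast+
    \<comment> \<open>The path of \<open>j\<close> cannot reach the last point first: then
      \<open>w i < w j <= x' < x\<close>, and \<open>(w i, Suc m)\<close> would surround
      \<open>(x, y)\<close>.\<close>
    have "(x', Suc m) \<notin> T j"
    proof
      assume "(x', Suc m) \<in> T j"
      then have "w i < x"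
        using w_min[OF assms(2)] assms(3) x by fastforce
      then show False
        using meet[OF assms(1) w_mem[OF assms(1)] less.prems(5)] x less.prems by simp
    qed
    then have f: "(x', Suc y') \<in> T j \<and> y' < m \<or> (Suc x', y') \<in> T j"
      using successor[OF assms(2) less.prems(6)] less.prems(4) by (cases "y' = m") auto
    have e: "(x, Suc y) \<in> T i \<or> (Suc x, y) \<in> T i"
      using successor[OF assms(1) less.prems(5)] x less.prems by auto
    have m: "2 * m - (x + y) > 2 * m - Suc (x + y)"
      using x less.prems b by linarith
    from e f show ?thesis
      using less.hyps[of x "Suc y" x' "Suc y'"] less.hyps[of x "Suc y" "Suc x'" y']
        less.hyps[of "Suc x" y x' "Suc y'"] less.hyps[of "Suc x" y "Suc x'" y'] m x less.prems
      by auto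
  qed
qed

text \<open>Brings the class with the smaller \<open>v\<close> up to the endpoint sum at which the
  other class enters the interior.\<close>

lemma interior_level:
  assumes "i \<in> I" "(1, u) \<in> T i" "u + d \<le> m"
  shows "\<exists>x y. 0 < x \<and> (x, y) \<in> T i \<and> x + y = 1 + u + d"
  using assms(3)
proof (induction d)
  case 0
  then show ?case using assms(2) by auto
next
  case (Suc d)
  then obtain x y where xy: "0 < x" "(x, y) \<in> T i" "x + y = 1 + u + d" by auto
  then have "y \<le> m" using Suc.prems by linarith
  then have "(x, Suc y) \<in> T i \<or> (Suc x, y) \<in> T i"
    using successor[OF assms(1) xy(2)] by blast
  then show ?case
    using xy by fastforce
qed

text \<open>By maximality of \<open>v\<close>, each path enters the interior at
  \<open>(1, v l)\<close>. The class \<open>i\<close> enters first, and at the sum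
  \<open>1 + v j\<close> its left endpoint is at least 1, the left endpoint of \<open>j\<close>;
  then \<open>interior_sweep\<close> applies.\<close>

lemma crossing:
  assumes "i \<in> I" "j \<in> I" "v i < v j" "w i < w j"
  shows "\<exists>a b. 0 < a \<and> b \<le> m \<and> (a, b) \<in> T i \<and> (a, b) \<in> T j"
proof -
  have vj: "v j \<le> m"
    using v_eq_w_eq[OF assms(2)] v_le[OF assms(2)] assms(4) by linarith
  have one: "(1, v l) \<in> T l" if "l \<in> I" "v l \<le> m" for l
    using successor[OF that(1) v_mem[OF that(1)] that(2)] v_max[OF that(1), of "Suc (v l)"] by auto
  obtain x y where "0 < x" "(x, y) \<in> T i" "x + y = 1 + v j"
    using interior_level[OF assms(1) one, of "v j - v i"] assms vj by auto
  then show ?thesis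
    using interior_sweep[OF assms(1,2,4), of x y 1 "v j"] one[OF assms(2) vj] vj by auto
qed

section \<open>Counting when at most one class contains the outermost pair\<close>

context
  assumes unique: "\<And>i j. i \<in> I \<Longrightarrow> j \<in> I \<Longrightarrow> (0, Suc m) \<in> T i \<Longrightarrow> (0, Suc m) \<in> T j \<Longrightarrow> i = j"
begin

text \<open>Classes with equal \<open>v\<close> would share the step from \<open>(0, v)\<close> to
  \<open>(1, v)\<close>.\<close>

lemma inj_v: "inj_on v I"
proof (rule inj_onI, rule ccontr)
  fix i j assume ij: "i \<in> I" "j \<in> I" "v i = v j" "i \<noteq> j"
  have "v i \<le> m"
    using unique[OF ij(1,2)] ij v_mem[OF ij(1)] v_mem[OF ij(2)] v_le[OF ij(1)] by (cases "v i = Suc m") auto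
  then have "(Suc 0, v l) \<in> T l" if "l \<in> {i, j}" for l
    using successor[of l 0 "v l"] v_mem[of l] v_max[of l "Suc (v l)"] ij that by auto
  from this[of i] this[of j] show False
    using right_step_unique[OF ij(1,2,4) \<open>v i \<le> m\<close>, of 0] v_mem[OF ij(1)] v_mem[OF ij(2)] ij(3) by auto
qed

text \<open>Classes with equal \<open>w\<close> would share the step from \<open>(w, m)\<close> to
  \<open>(w, Suc m)\<close>.\<close>

lemma inj_w: "inj_on w I"
proof (rule inj_onI, rule ccontr)
  fix i j assume ij: "i \<in> I" "j \<in> I" "w i = w j" "i \<noteq> j"
  have "w i \<noteq> 0"
    using unique ij w_mem by metis
  then obtain x where x: "w i = Suc x"
    using not0_implies_Suc by blast
  have "(Suc x, m) \<in> T l" if "l \<in> {i, j}" for l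
    using predecessor[of l x "Suc m"] w_mem[of l] w_min[of l x] ij x that by auto
  from this[of i] this[of j] show False
    using up_step_unique[OF ij(1,2,4), of m x] w_mem[OF ij(1)] w_mem[OF ij(2)] ij(3) x by auto
qed

text \<open>In the first two cases the shared pair is an extreme edge of the class with the smaller
  \<open>v\<close>, so by injectivity of \<open>v\<close> and \<open>w\<close> it determines that
  class.\<close>

lemma ex_shared:
  assumes "i \<in> I" "j \<in> I" "v i < v j"
  shows "\<exists>e. e \<in> T i \<and> e \<in> T j \<and>
    (e = (0, v i) \<or> (0 < w i \<and> v i \<le> m \<and> e = (w i, Suc m)) \<or> (0 < fst e \<and> snd e \<le> m))"
proof -
  have "i \<noteq> j" using assms by auto
  then consider "w i < w j" | "w j < w i"
    using inj_w assms by (metis inj_onD linorder_less_linear)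
  then show ?thesis
  proof cases
    case 1
    then show ?thesis using crossing[OF assms] by auto
  next
    case 2
    then show ?thesis
      using nested[OF assms 2] v_mem[OF assms(1)] w_mem[OF assms(1)] v_le[OF assms(2)] assms(3) by auto
  qed
qed

text \<open>Every pair of classes is charged to a shared edge, in such a way that an edge lying in \<open>r\<close>
  classes is charged by at most \<open>r - 1\<close> pairs.\<close>
lemma card_edges_pairs_le:
  "card {(i, j). i \<in> I \<and> j \<in> I \<and> v i < v j} + card (edges (m + 2)) \<le> card I * (m + 2)"
proof -
  define Q where "Q = {(i, j). i \<in> I \<and> j \<in> I \<and> v i < v j}"
  have "\<forall>p\<in>Q. \<exists>e. e \<in> T (fst p) \<and> e \<in> T (snd p) \<and> (e = (0, v (fst p)) \<or>
    (0 < w (fst p) \<and> v (fst p) \<le> m \<and> e = (w (fst p), Suc m)) \<or> (0 < fst e \<and> snd e \<le> m))"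
    using ex_shared by (auto simp: Q_def)
  then obtain \<phi> where \<phi>: "\<And>p. p \<in> Q \<Longrightarrow> \<phi> p \<in> T (fst p) \<and> \<phi> p \<in> T (snd p) \<and> (\<phi> p = (0, v (fst p)) \<or>
    (0 < w (fst p) \<and> v (fst p) \<le> m \<and> \<phi> p = (w (fst p), Suc m)) \<or> (0 < fst (\<phi> p) \<and> snd (\<phi> p) \<le> m))"
    by metis
  \<comment> \<open>Edges at an end point determine \<open>i\<close> by injectivity of
    \<open>v\<close> or \<open>w\<close>. An interior edge lies in at most two classes, which
    \<open>v\<close> then orders.\<close>
  have same_fst: "fst p = fst q" if pq: "p \<in> Q" "q \<in> Q" "\<phi> p = \<phi> q" for p q
  proof -
    obtain i j i' j' where p: "p = (i, j)" and q: "q = (i', j')"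
      by (cases p; cases q)
    have I: "i \<in> I" "j \<in> I" "i' \<in> I" "j' \<in> I" "v i < v j" "v i' < v j'"
      using pq by (auto simp: Q_def p q)
    obtain a b where ab: "\<phi> p = (a, b)" by (cases "\<phi> p")
    have mem: "(a, b) \<in> T i" "(a, b) \<in> T j" "(a, b) \<in> T i'" "(a, b) \<in> T j'"
      using \<phi>[OF pq(1)] \<phi>[OF pq(2)] ab pq(3) by (auto simp: p q)
    have c: "(a, b) = (0, v l) \<or> 0 < w l \<and> v l \<le> m \<and> (a, b) = (w l, Suc m) \<or> 0 < a \<and> b \<le> m"
      if "l \<in> {i, i'}" for l
      using that \<phi>[OF pq(1)] \<phi>[OF pq(2)] ab pq(3)[symmetric] by (auto simp: p q)
    have vm: "v i \<le> m" "v i' \<le> m"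
      using I v_le[of j] v_le[of j'] by auto
    consider "a = 0" | "0 < a" "b = Suc m" | "0 < a" "b \<le> m"
      using bounds[OF mem(1) I(1)] by linarith
    then show ?thesis
    proof cases
      case 1
      then have "v i = v i'"
        using c[of i] c[of i'] by auto
      then show ?thesis
        using inj_v I by (simp add: p q inj_on_eq_iff)
    next
      case 2
      then have "w i = w i'"
        using c[of i] c[of i'] by auto
      then show ?thesis
        using inj_w I by (simp add: p q inj_on_eq_iff)
    next
      case 3
      then obtain x where x: "a = Suc x" by (cases a) auto
      have "i' \<in> {i, j}" "j' \<in> {i, j}"
        using interior_multiplicity[of i j i' b x] interior_multiplicity[of i j j' b x] I mem 3(2) x by auto
      then show ?thesis
        using I by (auto simp: p q)
    qed
  qed
  \<comment> \<open>A charged edge is owned by the common first class of the pairs charging it, any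
    other edge by an arbitrary class containing it.\<close>
  define owner where "owner e = (if \<exists>p\<in>Q. \<phi> p = e then fst (SOME p. p \<in> Q \<and> \<phi> p = e) else SOME i. i \<in> I \<and> e \<in> T i)" for e
  have owner_\<phi>: "owner (\<phi> p) = fst p" if "p \<in> Q" for p
  proof -
    have "(SOME q. q \<in> Q \<and> \<phi> q = \<phi> p) \<in> Q \<and> \<phi> (SOME q. q \<in> Q \<and> \<phi> q = \<phi> p) = \<phi> p"
      by (rule someI[of "\<lambda>q. q \<in> Q \<and> \<phi> q = \<phi> p"]) (use that in simp)
    then show ?thesis
      using that same_fst[of "SOME q. q \<in> Q \<and> \<phi> q = \<phi> p" p] by (auto simp: owner_def)
  qed
  have owner_mem: "owner e \<in> I \<and> e \<in> T (owner e)" if "e \<in> edges (m + 2)" for e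
  proof (cases "\<exists>p\<in>Q. \<phi> p = e")
    case True
    then obtain p where "p \<in> Q" "\<phi> p = e" by auto
    then show ?thesis using owner_\<phi>[of p] \<phi>[of p] by (auto simp: Q_def)
  next
    case False
    have "\<exists>i. i \<in> I \<and> e \<in> T i" using that Union_eq by auto
    from someI_ex[OF this] show ?thesis using False by (auto simp: owner_def)
  qed
  \<comment> \<open>Pairs of classes and edges are sent injectively to disjoint sets of incidences
    (class, edge), since the second class of a pair never owns the edge it charges.\<close>
  define f where "f = (\<lambda>p. (snd p, \<phi> p))"
  define g where "g = (\<lambda>e. (owner e, e))"
  have "finite Q"
    by (rule finite_subset[of _ "I \<times> I"]) (auto simp: Q_def finite_I)
  have sub: "f ` Q \<union> g ` edges (m + 2) \<subseteq> Sigma I T"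
    using \<phi> owner_mem by (fastforce simp: f_def g_def Q_def)
  have "inj_on f Q"
  proof (rule inj_onI)
    fix p q assume pq: "p \<in> Q" "q \<in> Q" "f p = f q"
    then have "\<phi> p = \<phi> q" "snd p = snd q" by (simp_all add: f_def)
    with same_fst[OF pq(1,2)] show "p = q" by (simp add: prod_eq_iff)
  qed
  moreover have "inj_on g (edges (m + 2))"
    by (rule inj_onI) (auto simp: g_def)
  moreover have "f ` Q \<inter> g ` edges (m + 2) = {}"
  proof -
    have "snd p \<noteq> owner (\<phi> p)" if "p \<in> Q" for p
      using that owner_\<phi>[OF that] by (auto simp: Q_def)
    then show ?thesis by (auto simp: f_def g_def)
  qed
  ultimately have "card Q + card (edges (m + 2)) = card (f ` Q \<union> g ` edges (m + 2))"
    using \<open>finite Q\<close> by (simp add: card_Un_disjoint card_image)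
  also have "\<dots> \<le> card (Sigma I T)"
    by (rule card_mono[OF _ sub]) (simp add: finite_I finite_T)
  also have "\<dots> = (\<Sum>i\<in>I. card (T i))"
    using finite_I finite_T by (simp add: card_SigmaI)
  also have "\<dots> \<le> (\<Sum>i\<in>I. m + 2)"
    using Union_eq meet by (intro sum_mono card_thrackle_le) auto
  finally show ?thesis
    by (simp add: Q_def)
qed

lemma card_pairs: "2 * card {(i, j). i \<in> I \<and> j \<in> I \<and> v i < v j} + card I = card I * card I"
proof -
  let ?Q = "{(i, j). i \<in> I \<and> j \<in> I \<and> v i < v j}" and ?D = "(\<lambda>i. (i, i)) ` I"
  let ?R = "(\<lambda>(i, j). (j, i)) ` ?Q"
  have fin: "finite ?Q"
    by (rule finite_subset[of _ "I \<times> I"]) (auto simp: finite_I)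
  have "card (?Q \<union> ?R \<union> ?D) = card ?Q + card ?R + card ?D"
    using fin finite_I by (subst card_Un_disjoint; auto)+
  moreover have "card ?R = card ?Q"
    by (rule card_image) (auto simp: inj_on_def)
  moreover have "card ?D = card I"
    by (subst card_image) (auto simp: inj_on_def)
  moreover have "?Q \<union> ?R \<union> ?D = I \<times> I"
  proof -
    have "i = j" if "i \<in> I" "j \<in> I" "\<not> v i < v j" "\<not> v j < v i" for i j
      using inj_onD[OF inj_v, of i j] that by auto
    then show ?thesis by (auto simp: image_iff)
  qed
  ultimately show ?thesis
    by (simp add: card_cartesian_product)
qed

text \<open>With \<open>k = card I\<close> and \<open>d = m + 2 - k\<close>, the count reads
  \<open>d * d <= 2 * k + d\<close>; adding \<open>d\<close> to both sides gives the claim.\<close>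

lemma quadratic_bound: "(m + 2 - card I) * (m + 2 - card I + 1) \<le> 2 * (m + 2)"
proof (cases "card I \<le> m + 2")
  case True
  then obtain d where d: "m + 2 = card I + d"
    using le_Suc_ex by blast
  have "card I * card I + (m + 2) * (m + 2) \<le> 2 * card I * (m + 2) + card I + (m + 2)"
    using card_edges_pairs_le card_edges[of "m + 2"] card_pairs by (simp add: algebra_simps)
  then show ?thesis
    unfolding d by (simp add: algebra_simps)
qed simp

end

text \<open>Every pair of inner points lies strictly inside \<open>(0, Suc m)\<close>, so the
  classes \<open>i\<close> and \<open>j\<close> cover none of them. Indices are shifted down by
  one.\<close>

lemma drop_two_stars:
  assumes "i \<in> I" "j \<in> I" "i \<noteq> j" "(0, Suc m) \<in> T i" "(0, Suc m) \<in> T j"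
  shows "thrackle_cover m (I - {i, j}) (\<lambda>l. {(a, b). b < m \<and> (Suc a, Suc b) \<in> T l})"
proof -
  let ?S = "\<lambda>l. {(a, b). b < m \<and> (Suc a, Suc b) \<in> T l}"
  have star: "(Suc a, Suc b) \<notin> T l" if "b < m" "l \<in> {i, j}" for a b l
    using meet[of l "(0, Suc m)" "(Suc a, Suc b)"] assms that by auto
  have "\<not> apart e f" if l: "l \<in> I" "e \<in> ?S l" "f \<in> ?S l" for l e f
  proof -
    obtain a b c d where "e = (a, b)" "f = (c, d)" by (cases e; cases f)
    then show ?thesis
      using meet[OF l(1), of "(Suc a, Suc b)" "(Suc c, Suc d)"] l(2,3) by simp
  qed
  moreover have "(a, b) \<in> (\<Union>l\<in>I - {i, j}. ?S l) \<longleftrightarrow> (a, b) \<in> edges m" for a b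
  proof
    assume "(a, b) \<in> edges m"
    then have "(Suc a, Suc b) \<in> (\<Union>l\<in>I. T l)" "b < m"
      by (simp_all add: Union_eq)
    then show "(a, b) \<in> (\<Union>l\<in>I - {i, j}. ?S l)"
      using star by blast
  qed (use bounds in fastforce)
  ultimately show ?thesis
    unfolding thrackle_cover_def by (intro conjI ballI) (blast, simp add: set_eq_iff)
qed

end

section \<open>The lower bound by induction on the number of points\<close>

lemma optimal_cover_exists:
  assumes "finite I" "thrackle_cover (m + 2) I T"
  shows "\<exists>T. optimal_cover m I T"
proof -
  have "total_length I T' \<le> (\<Sum>i\<in>I. \<Sum>(a, b)\<in>edges (m + 2). b - a)" if "thrackle_cover (m + 2) I T'" for T'
    unfolding total_length_def using that
    by (intro sum_mono sum_mono2) (auto simp: thrackle_cover_def)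
  then obtain T where "thrackle_cover (m + 2) I T"
      "\<And>T'. thrackle_cover (m + 2) I T' \<Longrightarrow> total_length I T' \<le> total_length I T"
    using ex_has_greatest_nat[of "thrackle_cover (m + 2) I" T "total_length I"] assms(2)
    by (metis less_Suc_eq_le)
  then show ?thesis
    using assms(1) by (auto simp: optimal_cover_def)
qed

lemma thrackle_cover_bound:
  assumes "finite I" "thrackle_cover n I T"
  shows "(n - card I) * (n - card I + 1) \<le> 2 * n"
  using assms
proof (induction n arbitrary: I T rule: less_induct)
  case (less n)
  show ?case
  proof (cases "n < 2")
    case True
    then have "n = 0 \<or> n = 1" by linarith
    then have "n - card I = 0 \<or> n = 1 \<and> n - card I = 1" by linarith
    then show ?thesis by auto
  next
    case False
    then obtain m where n: "n = m + 2"
      by (metis add.commute le_Suc_ex not_less)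
    obtain S where "optimal_cover m I S"
      using optimal_cover_exists less.prems by (metis n)
    then interpret optimal_cover m I S .
    show ?thesis
    proof (cases "\<exists>i\<in>I. \<exists>j\<in>I. i \<noteq> j \<and> (0, Suc m) \<in> S i \<and> (0, Suc m) \<in> S j")
      case True
      then obtain i j where ij: "i \<in> I" "j \<in> I" "i \<noteq> j" "(0, Suc m) \<in> S i" "(0, Suc m) \<in> S j"
        by auto
      \<comment> \<open>There are at least two classes, so removing two points and two classes
        leaves the truncated difference unchanged.\<close>
      have "card {i, j} \<le> card I"
        using ij by (intro card_mono finite_I) auto
      then have "card (I - {i, j}) + 2 = card I"
        using ij finite_I by (simp add: card_Diff_subset)
      then have "m - card (I - {i, j}) = n - card I"
        by (simp add: n)
      then show ?thesis
        using less.IH[OF _ _ drop_two_stars[OF ij]] finite_I n by simp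
    next
      case False
      then show ?thesis
        using quadratic_bound n by blast
    qed
  qed
qed

subsection \<open>The triangular colouring\<close>

definition tri :: "nat \<Rightarrow> nat" where
  "tri b = (\<Sum>i\<le>b. i)"

lemma tri_0 [simp]: "tri 0 = 0" and tri_Suc [simp]: "tri (Suc b) = tri b + Suc b"
  by (simp_all add: tri_def)

lemma tri_mono: "a \<le> b \<Longrightarrow> tri a \<le> tri b"
  unfolding tri_def by (rule sum_mono2) auto

lemma two_tri: "2 * tri b = b * (b + 1)"
  by (induction b) auto

text \<open>Here \<open>b\<close> is the block of \<open>x\<close> and \<open>i\<close> its position
  there; block \<open>b\<close> has \<open>b + 1\<close> elements.\<close>

lemma ex_tri: "\<exists>b i. x = tri b + i \<and> i \<le> b"
proof (induction x)
  case (Suc x)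
  then obtain b i where "x = tri b + i" "i \<le> b" by auto
  then show ?case
    by (cases "i = b") (force intro: exI[of _ "Suc b"], force intro: exI[of _ b] exI[of _ "Suc i"])
qed (auto intro: exI[of _ 0])

definition block_ends :: "nat set" where
  "block_ends = {tri b + b | b. True}"

text \<open>The class of \<open>g = tri b + i\<close> with \<open>i < b\<close> joins \<open>g\<close> to the vertices after it, up to the end
  \<open>tri (b - i) - 1\<close> of block \<open>b - i - 1\<close> in the cyclic order, and joins \<open>g + 1\<close> to the remaining ones.\<close>
definition color_class :: "nat \<Rightarrow> nat \<Rightarrow> (nat \<times> nat) set" where
  "color_class b i = {(x, y). x < y \<and> (x = tri b + i \<or> y = tri b + i \<and> x < tri (b - i) \<or>
     y = tri b + i + 1 \<and> tri (b - i) \<le> x + 1)}"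

text \<open>Edges with the same centre share it. Earlier neighbours of \<open>g = tri b + i\<close>
  are at most \<open>tri (b - i) - 1\<close>, those of \<open>g + 1\<close> at least that, so edges
  of different centres cross or share an endpoint.\<close>

lemma color_class_meet:
  assumes "i < b" "e \<in> color_class b i" "f \<in> color_class b i"
  shows "\<not> apart e f"
proof -
  have "tri (b - i) \<le> tri b"
    by (rule tri_mono) simp
  then show ?thesis
    using assms unfolding color_class_def by auto
qed

lemma color_class_cover:
  assumes "x < y"
  shows "\<exists>b i. i < b \<and> tri b + i \<le> y \<and> (x, y) \<in> color_class b i"
proof -
  obtain b i where x: "x = tri b + i" "i \<le> b"
    using ex_tri by blast
  obtain c j where y: "y = tri c + j" "j \<le> c"
    using ex_tri by blast
  show ?thesis
  proof (cases "i < b")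
    \<comment> \<open>If \<open>x\<close> does not end its block, its own class contains all later
      neighbours.\<close>
    case True
    then show ?thesis
      using assms x by (intro exI[of _ b] exI[of _ i]) (auto simp: color_class_def)
  next
    case False
    then have xb: "x + 1 = tri (Suc b)" using x by simp
    have "b < c"
    proof (rule ccontr)
      assume "\<not> b < c"
      then have "tri (Suc c) \<le> tri (Suc b)" by (intro tri_mono) simp
      then show False using xb y assms by simp
    qed
    show ?thesis
    \<comment> \<open>Now \<open>x\<close> ends block \<open>b\<close> and \<open>y\<close> has
      position \<open>j\<close> in block \<open>c\<close>. The edge goes to the class centred at
      \<open>y\<close> or to the one centred at \<open>y - 1\<close>, depending on which side of the
      threshold \<open>x\<close> lies.\<close>
    proof (cases "b < c - j")
      case True
      then have "tri (Suc b) \<le> tri (c - j)" by (intro tri_mono) simp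
      then show ?thesis
        using assms True xb y by (intro exI[of _ c] exI[of _ j]) (auto simp: color_class_def)
    next
      case False
      then obtain j' where j: "j = Suc j'"
        using \<open>b < c\<close> by (cases j) auto
      have "tri (c - j') \<le> tri (Suc b)"
        using False j y by (intro tri_mono) simp
      then show ?thesis
        using assms xb y j by (intro exI[of _ c] exI[of _ j']) (auto simp: color_class_def)
    qed
  qed
qed

lemma not_block_end:
  assumes "i < b"
  shows "tri b + i \<notin> block_ends"
proof
  assume "tri b + i \<in> block_ends"
  then obtain c where c: "tri b + i = tri c + c" by (auto simp: block_ends_def)
  then show False
    using assms tri_mono[of "Suc b" c] tri_mono[of "Suc c" b] by (cases "b < c"; cases "c < b") auto
qed

text \<open>The first \<open>t\<close> blocks fit below \<open>n\<close>, so at least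
  \<open>t\<close> block ends are discarded.\<close>

lemma card_block_ends:
  assumes "tri t \<le> n"
  shows "card ({..<n} - block_ends) \<le> n - t"
proof -
  have lt: "tri b + b < n" if "b < t" for b
    using assms tri_mono[of "Suc b" t] that by simp
  have "strict_mono (\<lambda>b. tri b + b)"
    by (rule strict_monoI_Suc) simp
  then have "card ((\<lambda>b. tri b + b) ` {..<t}) = t"
    by (simp add: card_image strict_mono_on_imp_inj_on strict_mono_imp_inj_on)
  moreover have "(\<lambda>b. tri b + b) ` {..<t} \<subseteq> {..<n} \<inter> block_ends"
    using lt by (auto simp: block_ends_def)
  ultimately have "t \<le> card ({..<n} \<inter> block_ends)"
    by (metis card_mono finite_Int finite_lessThan)
  then show ?thesis
    by (simp add: card_Diff_subset_Int)
qed

lemma thrackle_coloring: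
  assumes "tri t \<le> n"
  shows "\<exists>c. (\<forall>e\<in>edges n. c e < n - t) \<and> (\<forall>e\<in>edges n. \<forall>f\<in>edges n. c e = c f \<longrightarrow> \<not> apart e f)"
proof -
  have "\<exists>g. g \<in> {..<n} - block_ends \<and> (\<exists>b i. g = tri b + i \<and> i < b \<and> e \<in> color_class b i)"
    if e_in: "e \<in> edges n" for e
  proof -
    obtain x y where e: "e = (x, y)" by (cases e)
    then obtain b i where bi: "i < b" "tri b + i \<le> y" "(x, y) \<in> color_class b i"
      using e_in color_class_cover mem_edges by metis
    then show ?thesis
      using not_block_end[OF bi(1)] bi e_in e by (intro exI[of _ "tri b + i"]) auto
  qed
  then obtain g where g: "\<And>e. e \<in> edges n \<Longrightarrow> g e \<in> {..<n} - block_ends"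
      "\<And>e. e \<in> edges n \<Longrightarrow> \<exists>b i. g e = tri b + i \<and> i < b \<and> e \<in> color_class b i"
    by metis
  obtain h where h: "bij_betw h ({..<n} - block_ends) {..<card ({..<n} - block_ends)}"
    using ex_bij_betw_finite_nat[of "{..<n} - block_ends"] by (auto simp: lessThan_atLeast0)
  have "\<not> apart e f" if ef: "e \<in> edges n" "f \<in> edges n" "h (g e) = h (g f)" for e f
  proof -
    have gg: "g e = g f"
      using inj_onD[OF bij_betw_imp_inj_on[OF h] ef(3)] g(1) ef(1,2) by blast
    obtain b i c j where bi: "g e = tri b + i" "i < b" "e \<in> color_class b i"
      and cj: "g f = tri c + j" "j < c" "f \<in> color_class c j"
      using g(2) ef by metis
    have "b = c"
      using gg bi(1,2) cj(1,2) tri_mono[of "Suc b" c] tri_mono[of "Suc c" b]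
      by (cases "b < c"; cases "c < b") auto
    then show ?thesis
      using color_class_meet bi cj gg by auto
  qed
  moreover have "h (g e) < n - t" if "e \<in> edges n" for e
    using bij_betw_apply[OF h g(1)[OF that]] card_block_ends[OF assms] by simp
  ultimately show ?thesis
    by (intro exI[of _ "h \<circ> g"]) auto
qed

subsection \<open>Points in convex position\<close>

text \<open>Twice the signed area of the triangle, positive for counterclockwise order.\<close>

definition orient :: "real^2 \<Rightarrow> real^2 \<Rightarrow> real^2 \<Rightarrow> real" where
  "orient a b c = (b$1 - a$1) * (c$2 - a$2) - (b$2 - a$2) * (c$1 - a$1)"

lemma orient_rotate: "orient a b c = orient b c a"
  by (simp add: orient_def algebra_simps)

lemma orient_segment:
  "orient a b ((1 - u) *\<^sub>R c + u *\<^sub>R d) = (1 - u) * orient a b c + u * orient a b d"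
  by (simp add: orient_def algebra_simps)

lemma segments_disjoint:
  assumes "orient a b c > 0" "orient a b d > 0"
  shows "closed_segment a b \<inter> closed_segment c d = {}"
proof -
  have "orient a b x = 0" if "x \<in> closed_segment a b" for x
    using that by (auto simp: in_segment orient_segment) (simp add: orient_def)
  moreover have "orient a b x > 0" if x: "x \<in> closed_segment c d" for x
  proof -
    obtain u where u: "0 \<le> u" "u \<le> 1" "x = (1 - u) *\<^sub>R c + u *\<^sub>R d"
      using x by (auto simp: in_segment)
    show ?thesis
      using assms u(1,2) convex_bound_lt[of "- orient a b c" 0 "- orient a b d" "1 - u" u]
      by (simp add: u(3) orient_segment)
  qed
  ultimately show ?thesis
    by (metis disjoint_iff less_irrefl)
qed

lemma diagonals_meet:
  assumes "orient a c b > 0" "orient a b d > 0" "orient a c d > 0" "orient c b d > 0"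
  shows "closed_segment a b \<inter> closed_segment c d \<noteq> {}"
proof -
  \<comment> \<open>Twice the area of the quadrilateral \<open>a, c, b, d\<close>, which either
    diagonal splits into two triangles. The area ratios \<open>s\<close> and \<open>t\<close> are
    the parameters of the crossing point on the two diagonals.\<close>
  let ?N = "orient a c b + orient a b d"
  define s where "s = orient a c d / ?N"
  define t where "t = orient a c b / ?N"
  have N: "?N = orient a c d + orient c b d" "?N \<noteq> 0"
    using assms by (simp_all add: orient_def algebra_simps)
  have "?N * ((1 - s) * a$i + s * b$i) = ?N * ((1 - t) * c$i + t * d$i)" if "i = 1 \<or> i = 2" for i :: 2
  proof -
    have st: "?N * s = orient a c d" "?N * t = orient a c b"
      using N(2) by (simp_all add: s_def t_def)
    have lin: "?N * ((1 - r) * x + r * y) = ?N * x + (?N * r) * (y - x)" for r x y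
      by (simp add: algebra_simps)
    show ?thesis
      unfolding lin st using that by (auto simp: orient_def algebra_simps)
  qed
  then have eq: "(1 - s) *\<^sub>R a + s *\<^sub>R b = (1 - t) *\<^sub>R c + t *\<^sub>R d"
    using N(2) by (simp add: vec_eq_iff forall_2)
  have "0 \<le> s" "s \<le> 1" "0 \<le> t" "t \<le> 1"
    using assms N(1) by (simp_all add: s_def t_def)
  with eq have "(1 - s) *\<^sub>R a + s *\<^sub>R b \<in> closed_segment a b"
    "(1 - s) *\<^sub>R a + s *\<^sub>R b \<in> closed_segment c d"
    by (metis in_segment(1))+
  then show ?thesis by blast
qed

text \<open>Insertion sort for a relation that is total and transitive only on \<open>A\<close>, as
  is the angular order around a point.\<close>

lemma strictly_sorted_list_exists:
  assumes "finite A"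
    and total: "\<And>x y. x \<in> A \<Longrightarrow> y \<in> A \<Longrightarrow> x \<noteq> y \<Longrightarrow> R x y \<or> R y x"
    and trans: "\<And>x y z. x \<in> A \<Longrightarrow> y \<in> A \<Longrightarrow> z \<in> A \<Longrightarrow> R x y \<Longrightarrow> R y z \<Longrightarrow> R x z"
  shows "\<exists>xs. set xs = A \<and> distinct xs \<and> sorted_wrt R xs"
  using assms
proof (induction A rule: finite_induct)
  case empty
  show ?case
    by (intro exI[of _ "[]"]) simp
next
  case (insert x A)
  have "\<exists>xs. set xs = A \<and> distinct xs \<and> sorted_wrt R xs"
    by (rule insert.IH) (meson insert.prems insertI2)+
  then obtain xs where xs: "set xs = A" "distinct xs" "sorted_wrt R xs"
    by auto
  let ?zs = "filter (\<lambda>y. R y x) xs @ x # filter (\<lambda>y. \<not> R y x) xs"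
  have R: "R x y" if "y \<in> A" "\<not> R y x" for y
    using insert.prems(1)[of x y] insert.hyps that by auto
  have "R y z" if "y \<in> A" "z \<in> A" "R y x" "\<not> R z x" for y z
    using insert.prems(2)[of y x z] R that by auto
  then have "sorted_wrt R ?zs"
    using xs R by (auto simp: sorted_wrt_append sorted_wrt_filter)
  moreover have "set ?zs = insert x A" "distinct ?zs"
    using xs insert.hyps by auto
  ultimately show ?case by blast
qed

lemma extreme_point_notin_hull:
  assumes "p extreme_point_of (convex hull P)"
  shows "p \<notin> convex hull (P - {p})"
proof -
  have "convex (convex hull P - {p})"
    using assms extreme_point_of_stillconvex[OF convex_convex_hull] by blast
  moreover have "P - {p} \<subseteq> convex hull P - {p}"
    using hull_subset by fastforce
  ultimately have "convex hull (P - {p}) \<subseteq> convex hull P - {p}"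
    by (rule hull_minimal[rotated])
  then show ?thesis by auto
qed

lemma orient_eq_0_imp_collinear:
  assumes "orient a b c = 0"
  shows "collinear {a, b, c}"
proof -
  have "collinear {0, b - a, c - a}"
  proof (cases "b$1 = a$1")
    case True
    show ?thesis
    proof (cases "b$2 = a$2")
      case True
      with \<open>b$1 = a$1\<close> have "b - a = 0" by (simp add: vec_eq_iff forall_2)
      then show ?thesis by simp
    next
      case False
      then have "c - a = ((c$2 - a$2) / (b$2 - a$2)) *\<^sub>R (b - a)"
        using assms True by (simp add: vec_eq_iff forall_2 orient_def)
      then show ?thesis by (metis collinear_lemma)
    qed
  next
    case False
    then have "c$2 - a$2 = (c$1 - a$1) / (b$1 - a$1) * (b$2 - a$2)"
      using assms by (simp add: orient_def eq_divide_eq mult.commute)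
    then have "c - a = ((c$1 - a$1) / (b$1 - a$1)) *\<^sub>R (b - a)"
      using False by (simp add: vec_eq_iff forall_2)
    then show ?thesis by (metis collinear_lemma)
  qed
  then show ?thesis
    using collinear_3[of b a c] by (simp add: insert_commute)
qed

text \<open>Angular order around \<open>p\<close> is transitive within an open half-plane bounded by
  a line through \<open>p\<close>. The identity is the linear dependence of the three difference
  vectors, paired with \<open>a\<close>.\<close>

lemma orient_trans:
  assumes "a \<bullet> p < a \<bullet> x" "a \<bullet> p < a \<bullet> y" "a \<bullet> p < a \<bullet> z"
    and "orient p x y > 0" "orient p y z > 0"
  shows "orient p x z > 0"
proof -
  have "(a \<bullet> y - a \<bullet> p) * orient p x z =
      (a \<bullet> x - a \<bullet> p) * orient p y z + (a \<bullet> z - a \<bullet> p) * orient p x y"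
    by (simp add: orient_def inner_vec_def sum_2 algebra_simps)
  also have "\<dots> > 0"
    using assms by (intro add_pos_pos mult_pos_pos) auto
  finally show ?thesis
    using assms(2) by (simp add: zero_less_mult_iff)
qed

text \<open>If the quadrilateral \<open>p, x, y, z\<close> is not convex at \<open>y\<close>, then \<open>y\<close> lies in the triangle
  \<open>p, x, z\<close>.\<close>
lemma orient_of_extreme:
  assumes "orient p x y > 0" "orient p y z > 0" "orient p x z > 0"
    and "y \<notin> convex hull {p, x, z}"
  shows "orient x y z > 0"
proof (rule ccontr)
  assume "\<not> ?thesis"
  moreover have "orient x y z = orient p x y + orient p y z - orient p x z"
    by (simp add: orient_def algebra_simps)
  ultimately have le: "orient p y z + orient p x y \<le> orient p x z"
    by simp
  \<comment> \<open>The barycentric coordinates of \<open>y\<close> at \<open>x\<close> and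
    \<open>z\<close>, by Cramer's rule.\<close>
  let ?u = "orient p y z / orient p x z" and ?v = "orient p x y / orient p x z"
  have eq: "orient p x z * (y$i - p$i) = orient p y z * (x$i - p$i) + orient p x y * (z$i - p$i)"
    if "i = 1 \<or> i = 2" for i :: 2
    using that by (auto simp: orient_def algebra_simps)
  have "y$i = p$i + ?u * (x$i - p$i) + ?v * (z$i - p$i)" if "i = 1 \<or> i = 2" for i :: 2
  proof -
    have "Y = A / D * X + B / D * Z" if "D * Y = A * X + B * Z" "0 < D" for A B D X Y Z :: real
      using that by (simp add: field_simps)
    from this[OF eq[OF that] assms(3)] show ?thesis by simp
  qed
  then have "y = p + ?u *\<^sub>R (x - p) + ?v *\<^sub>R (z - p)"
    by (simp add: vec_eq_iff forall_2)
  moreover have "0 \<le> ?u" "0 \<le> ?v" "?u + ?v \<le> 1"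
    using assms(1-3) le by (simp_all add: add_divide_distrib[symmetric])
  ultimately show False
    using assms(4) unfolding convex_hull_3_alt by blast
qed

text \<open>A line separating one point \<open>q\<close> from the hull of the others puts those in a
  half-plane seen from \<open>q\<close>, where they are sorted by angle. Triples without
  \<open>q\<close> are handled by \<open>orient_of_extreme\<close>, since no point lies in a
  triangle of others.\<close>

lemma convex_enumeration:
  assumes "finite P" "card P = n" "n \<ge> 1" "strictly_convex_position P"
  shows "\<exists>p. bij_betw p {..<n} P \<and> (\<forall>i j k. i < j \<and> j < k \<and> k < n \<longrightarrow> orient (p i) (p j) (p k) > 0)"
proof -
  have ext: "q \<notin> convex hull (P - {q})" if "q \<in> P" for q
    using assms(4) that extreme_point_notin_hull unfolding strictly_convex_position_def by blast
  have ncol: "orient a b c \<noteq> 0" if "a \<in> P" "b \<in> P" "c \<in> P" "a \<noteq> b" "b \<noteq> c" "a \<noteq> c" for a b c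
    using assms(4) that orient_eq_0_imp_collinear[of a b c]
    unfolding strictly_convex_position_def by blast
  obtain q where q: "q \<in> P"
    using assms by (cases "P = {}") auto
  have "closed (convex hull (P - {q}))"
    using assms(1) by (intro compact_imp_closed finite_imp_compact_convex_hull) auto
  then obtain a b where ab: "a \<bullet> q < b" "\<And>x. x \<in> convex hull (P - {q}) \<Longrightarrow> a \<bullet> x > b"
    using separating_hyperplane_closed_point[OF convex_convex_hull _ ext[OF q]] by blast
  then have half: "a \<bullet> q < a \<bullet> x" if "x \<in> P - {q}" for x
    using hull_inc[OF that] ab by (meson less_trans)
  have "\<exists>xs. set xs = P - {q} \<and> distinct xs \<and> sorted_wrt (\<lambda>x y. orient q x y > 0) xs"
  proof (rule strictly_sorted_list_exists)
    fix x y assume "x \<in> P - {q}" "y \<in> P - {q}" "x \<noteq> y"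
    then have "orient q x y \<noteq> 0"
      using ncol[of q x y] q by blast
    moreover have "orient q y x = - orient q x y"
      by (simp add: orient_def algebra_simps)
    ultimately show "orient q x y > 0 \<or> orient q y x > 0" by linarith
  qed (use assms(1) half orient_trans in blast)+
  then obtain xs where xs: "set xs = P - {q}" "distinct xs" "sorted_wrt (\<lambda>x y. orient q x y > 0) xs"
    by blast
  define ys where "ys = q # xs"
  have ys: "set ys = P" "distinct ys"
    using xs q by (auto simp: ys_def)
  then have len: "length ys = n"
    using assms(2) distinct_card by metis
  have pos: "orient (ys ! i) (ys ! j) (ys ! k) > 0" if ijk: "i < j" "j < k" "k < n" for i j k
  proof -
    have base: "orient q (ys ! j) (ys ! k) > 0" if "0 < j" "j < k" "k < n" for j k
      using that xs(3) len sorted_wrt_nth_less[OF xs(3), of "j - 1" "k - 1"] by (simp add: ys_def)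
    show ?thesis
    proof (cases i)
      case 0
      then show ?thesis using base[of j k] ijk by (simp add: ys_def)
    next
      case (Suc i')
      have neq: "ys ! r \<noteq> ys ! s" if "r < n" "s < n" "r \<noteq> s" for r s
        using ys(2) len that by (simp add: nth_eq_iff_index_eq)
      have mem: "ys ! r \<in> P" if "r < n" for r
        using ys(1) len that nth_mem by blast
      have q0: "ys ! 0 = q" by (simp add: ys_def)
      have sub: "{q, ys ! i, ys ! k} \<subseteq> P - {ys ! j}"
        using neq[of 0 j] neq[of i j] neq[of k j] mem q ijk Suc q0 by auto
      then have "ys ! j \<notin> convex hull {q, ys ! i, ys ! k}"
        using ext[of "ys ! j"] mem[of j] ijk hull_mono[OF sub, of convex] by auto
      then show ?thesis
        using orient_of_extreme[OF base base base, of i j k] ijk Suc by auto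
    qed
  qed
  have "bij_betw ((!) ys) {..<n} P"
    using bij_betw_nth[OF ys(2), of "{..<n}" P] len ys(1) by (simp add: lessThan_atLeast0)
  then show ?thesis
    using pos by blast
qed

section \<open>From disjoint segments to apart pairs\<close>

locale convex_polygon =
  fixes n :: nat and p :: "nat \<Rightarrow> real^2"
  assumes ccw: "i < j \<Longrightarrow> j < k \<Longrightarrow> k < n \<Longrightarrow> orient (p i) (p j) (p k) > 0"
begin

definition seg :: "nat \<times> nat \<Rightarrow> (real^2) set" where
  "seg e = closed_segment (p (fst e)) (p (snd e))"

text \<open>In every case one segment lies strictly to the left of the line through the other,
  suitably directed.\<close>

lemma apart_imp_disjoint:
  assumes "e \<in> edges n" "f \<in> edges n" "apart e f"
  shows "seg e \<inter> seg f = {}"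
proof -
  obtain i j k l where e: "e = (i, j)" and f: "f = (k, l)" by (cases e; cases f)
  have lt: "i < j" "j < n" "k < l" "l < n" using assms by (auto simp: e f)
  consider "j < k" | "l < i" | "i < k" "l < j" | "k < i" "j < l"
    using assms(3) by (auto simp: e f)
  then show ?thesis
  proof cases
    case 1
    then show ?thesis
      using segments_disjoint[OF ccw ccw, of i j k l] lt by (simp add: seg_def e f)
  next
    case 2
    then show ?thesis
      using segments_disjoint[OF ccw ccw, of k l i j] lt by (auto simp add: seg_def e f)
  next
    case 3
    then show ?thesis
      using segments_disjoint[of "p j" "p i" "p k" "p l"] ccw[of i k j] ccw[of i l j] lt
        orient_rotate[of "p j" "p i" "p k"] orient_rotate[of "p j" "p i" "p l"]
      by (simp add: seg_def e f closed_segment_commute)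
  next
    case 4
    then show ?thesis
      using segments_disjoint[of "p l" "p k" "p i" "p j"] ccw[of k i l] ccw[of k j l] lt
        orient_rotate[of "p l" "p k" "p i"] orient_rotate[of "p l" "p k" "p j"]
      by (auto simp add: seg_def e f closed_segment_commute)
  qed
qed

text \<open>Pairs that are not apart share an endpoint or interleave; interleaving pairs are
  diagonals of a convex quadrilateral.\<close>

lemma disjoint_imp_apart:
  assumes "e \<in> edges n" "f \<in> edges n" "seg e \<inter> seg f = {}"
  shows "apart e f"
proof (rule ccontr)
  assume na: "\<not> apart e f"
  obtain i j k l where e: "e = (i, j)" and f: "f = (k, l)" by (cases e; cases f)
  have lt: "i < j" "j < n" "k < l" "l < n" using assms by (auto simp: e f)
  have "{i, j} \<inter> {k, l} = {}"
    using assms(3) by (auto simp: seg_def e f)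
  then consider "i < k" "k < j" "j < l" | "k < i" "i < l" "l < j"
    using na lt by (auto simp: e f; linarith)
  then show False
  proof cases
    case 1
    then show ?thesis
      using diagonals_meet[of "p i" "p k" "p j" "p l"] ccw lt assms(3) by (simp add: seg_def e f)
  next
    case 2
    then show ?thesis
      using diagonals_meet[of "p k" "p i" "p l" "p j"] ccw lt assms(3) by (simp add: seg_def e f Int_commute)
  qed
qed

end

lemma segments_eq:
  assumes "bij_betw p {..<n} P"
  shows "segments P = (\<lambda>(i, j). closed_segment (p i) (p j)) ` edges n"
proof -
  have "closed_segment a b \<in> (\<lambda>(i, j). closed_segment (p i) (p j)) ` edges n"
    if ab: "a \<in> P" "b \<in> P" "a \<noteq> b" for a b
  proof -
    obtain i j where ij: "i < n" "j < n" "a = p i" "b = p j"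
      using ab assms by (auto simp: bij_betw_def)
    then consider "i < j" | "j < i"
      using ab(3) by (metis linorder_less_linear)
    then show ?thesis
    proof cases
      case 1
      then show ?thesis using ij by (auto simp: image_iff intro!: bexI[of _ "(i, j)"])
    next
      case 2
      then show ?thesis
        using ij by (auto simp: image_iff closed_segment_commute intro!: bexI[of _ "(j, i)"])
    qed
  qed
  moreover have "p i \<in> P \<and> p j \<in> P \<and> p i \<noteq> p j" if "i < j" "j < n" for i j
    using assms that by (auto simp: bij_betw_def inj_on_eq_iff)
  ultimately show ?thesis
    unfolding segments_def by (fastforce simp: edges_def)
qed

text \<open>Completing the square in
  \<open>t * (t + 1) <= 2 * n < (t + 1) * (t + 2)\<close>.\<close>

lemma floor_triangular_root:
  assumes "tri t \<le> n" "n < tri (Suc t)"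
  shows "\<lfloor>sqrt (2 * real n + 1/4) - 1/2\<rfloor> = int t"
proof (rule floor_unique)
  have "t * (t + 1) \<le> 2 * n"
    using assms(1) two_tri[of t] by linarith
  then have "real (t * (t + 1)) \<le> real (2 * n)"
    by (simp only: of_nat_le_iff)
  then have "(real t + 1/2)\<^sup>2 \<le> 2 * real n + 1/4"
    by (simp add: power2_eq_square algebra_simps)
  then show "real_of_int (int t) \<le> sqrt (2 * real n + 1/4) - 1/2"
    using real_le_rsqrt by fastforce
  have "2 * n < (t + 1) * (t + 2)"
    using assms(2) two_tri[of "Suc t"] by simp
  then have "real (2 * n) < real ((t + 1) * (t + 2))"
    by (simp only: of_nat_less_iff)
  then have "2 * real n + 1/4 < (real t + 3/2)\<^sup>2"
    by (simp add: power2_eq_square algebra_simps)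
  then have "sqrt (2 * real n + 1/4) < real t + 3/2"
    by (intro real_less_lsqrt) auto
  then show "sqrt (2 * real n + 1/4) - 1/2 < real_of_int (int t) + 1"
    by simp
qed

theorem theorem1:
  fixes n :: nat and P :: "(real^2) set"
  assumes "n \<ge> 1"
    and "finite P" and "card P = n"
    and "strictly_convex_position P"
  shows "int (chromatic_number (segment_disjointness_graph P)) =
           int n - \<lfloor>sqrt (2 * real n + 1/4) - 1/2\<rfloor>"
proof -
  let ?G = "segment_disjointness_graph P"
  obtain p where p: "bij_betw p {..<n} P"
      "\<And>i j k. i < j \<Longrightarrow> j < k \<Longrightarrow> k < n \<Longrightarrow> orient (p i) (p j) (p k) > 0"
    using convex_enumeration[OF assms(2,3,1,4)] by blast
  interpret convex_polygon n p
    by unfold_locales (rule p(2))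
  have segs: "segments P = seg ` edges n"
    unfolding segments_eq[OF p(1)] by (simp add: seg_def case_prod_beta')
  \<comment> \<open>The number of full blocks among the first \<open>n\<close> indices, which is the
    value of the floor.\<close>
  obtain t i where t: "n = tri t + i" "i \<le> t"
    using ex_tri by blast
  then have tri: "tri t \<le> n" "n < tri (Suc t)" by simp_all
  have "t \<le> n"
    using tri(1) two_tri[of t] by (cases t) auto
  have "\<exists>c. proper_coloring ?G (n - t) c"
  proof -
    obtain c where c: "\<And>e. e \<in> edges n \<Longrightarrow> c e < n - t"
        "\<And>e f. e \<in> edges n \<Longrightarrow> f \<in> edges n \<Longrightarrow> c e = c f \<Longrightarrow> \<not> apart e f"
      using thrackle_coloring[OF tri(1)] by blast
    define pick where "pick = inv_into (edges n) seg"
    have pick: "pick s \<in> edges n" "seg (pick s) = s" if "s \<in> segments P" for s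
      using that by (simp_all add: pick_def segs inv_into_into f_inv_into_f)
    have "c (pick s) \<noteq> c (pick s')" if "s \<in> segments P" "s' \<in> segments P" "s \<inter> s' = {}" for s s'
      using that c(2) disjoint_imp_apart[of "pick s" "pick s'"] pick by metis
    moreover have "c (pick s) < n - t" if "s \<in> segments P" for s
      using c(1) pick(1) that by blast
    ultimately have "proper_coloring ?G (n - t) (c \<circ> pick)"
      by (auto simp: proper_coloring_def segment_disjointness_graph_def)
    then show ?thesis by blast
  qed
  moreover have "n - t \<le> k" if ex: "\<exists>c. proper_coloring ?G k c" for k
  proof (rule ccontr)
    assume "\<not> n - t \<le> k"
    then have "t + 1 \<le> n - k" by linarith
    obtain c where c: "proper_coloring ?G k c"
      using ex by blast
    then have "c ` segments P \<subseteq> {..<k}"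
      by (simp add: proper_coloring_def segment_disjointness_graph_def)
    then have "c (seg e) < k" if "e \<in> edges n" for e
      using that segs by blast
    moreover have "\<not> apart e f"
      if ef: "e \<in> edges n" "f \<in> edges n" "c (seg e) = c (seg f)" for e f
    proof
      assume "apart e f"
      then have "(seg e, seg f) \<in> parcs ?G"
        using ef apart_imp_disjoint[OF ef(1,2)] segs by (auto simp: segment_disjointness_graph_def)
      then show False
        using c ef(3) by (auto simp: proper_coloring_def)
    qed
    ultimately have "thrackle_cover n {..<k} (\<lambda>i. {e \<in> edges n. c (seg e) = i})"
      unfolding thrackle_cover_def by (auto simp del: apart.simps mem_edges)
    then have "(n - k) * (n - k + 1) \<le> 2 * n"
      using thrackle_cover_bound[of "{..<k}" n] by simp
    \<comment> \<open>Fewer than \<open>n - t\<close> colours would give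
      \<open>(t + 1) * (t + 2) <= 2 * n\<close>, against \<open>n < tri (Suc t)\<close>.\<close>
    moreover have "(t + 1) * (t + 1 + 1) \<le> (n - k) * (n - k + 1)"
      using \<open>t + 1 \<le> n - k\<close> by (intro mult_le_mono) auto
    ultimately show False
      using tri(2) two_tri[of "Suc t"] by simp
  qed
  ultimately have "chromatic_number ?G = n - t"
    unfolding chromatic_number_def by (rule Least_equality)
  then show ?thesis
    using \<open>t \<le> n\<close> by (simp add: floor_triangular_root[OF tri] of_nat_diff)
qed

end
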